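(* For every integer $d\ge 1$ and every integer $r\ge 2$ there exists a positive integer $t$ with the following property. Whenever $C\subset\mathbb{R}^d$ is a set of $(d+1)t$ points partitioned into $t$-point subsets $C_1,\ldots,C_{d+1}$, there exist pairwise disjoint sets $R_1,\ldots,R_r\subseteq C$, each of which is rainbow (i.e., $|R_i\cap C_j|\le 1$ for all $i\in[r]$, $j\in[d+1]$), such that $\bigcap_{i=1}^r\operatorname{conv}(R_i)\neq\emptyset$.
   Context: $[k]=\{1,\ldots,k\}$. The sets $C_1,\ldots,C_{d+1}$ are thought of as color classes. The sets $R_i$ are not required to cover $C$. *)

theory Defs
  imports "HOL-Analysis.Analysis"
begin

end

theory Submission
  imports Defs
begin

text \<open>
  Suppose that no point lies in the hulls of \<open>r\<close> disjoint rainbow sets. Then for each point \<open>x\<close> there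
  is a set \<open>Y x\<close> of at most \<open>r (d + 1)\<close> points of \<open>C\<close> that meets every rainbow set whose hull
  contains \<open>x\<close>, and by compactness one such set serves a whole cell of a fine cubical grid.
  Take \<open>d + 1\<close> translates of the grid along the diagonal, one per colour. A coordinate of \<open>x\<close> can
  lie on a wall of at most one translate, so \<open>x\<close> is interior to a cube of some translate.
  Give every cube of the \<open>i\<close>-th translate a point of colour \<open>i\<close> outside the
  sets \<open>Y\<close> of the at most \<open>2 ^ d\<close> grid cells near it, and interpolate with weights
  vanishing on the walls. This is a continuous self-map of the hull of \<open>C\<close>, whose value at \<open>x\<close>
  lies in the hull of a rainbow set disjoint from the set \<open>Y\<close> of the cell of \<open>x\<close>. So it has no fixed
  point, contradicting Brouwer's theorem.
\<close>

section \<open>Shifted cubical grids and weights vanishing on their walls\<close>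

text \<open>For \<open>N > 0\<close> the value names a half-open cube of side 1/N by its integer
  coordinates. Since \<open>restrict\<close> fixes the values off \<open>Basis\<close>, labels are
  elements of a \<open>PiE\<close> and can be counted there.\<close>

definition grid_cell :: "real \<Rightarrow> real \<Rightarrow> 'a::euclidean_space \<Rightarrow> 'a \<Rightarrow> int" where
  "grid_cell N s x = restrict (\<lambda>b. \<lfloor>N * (x \<bullet> b) - s\<rfloor>) Basis"

text \<open>|sin(pi y)| serves as a continuous function of period 1 whose zeros are exactly the
  integers, so the product detects walls in any direction.\<close>

definition wall_weight :: "real \<Rightarrow> real \<Rightarrow> 'a::euclidean_space \<Rightarrow> real" where
  "wall_weight N s x = (\<Prod>b\<in>Basis. \<bar>sin (pi * (N * (x \<bullet> b) - s))\<bar>)"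

lemma wall_weight_nonneg: "wall_weight N s x \<ge> 0"
  by (simp add: wall_weight_def prod_nonneg)

lemma isCont_wall_weight: "isCont (wall_weight N s) x"
  unfolding wall_weight_def by (intro continuous_intros)

lemma wall_weight_eq_0_iff:
  "wall_weight N s x = 0 \<longleftrightarrow> (\<exists>b\<in>Basis. N * (x \<bullet> b) - s \<in> \<int>)"
proof -
  have "sin (pi * y) = 0 \<longleftrightarrow> y \<in> \<int>" for y :: real
    by (auto simp: sin_zero_iff_int2 Ints_def mult.commute)
  then show ?thesis
    by (simp add: wall_weight_def)
qed

text \<open>Otherwise each of the d + 1 shifts has a direction in which \<open>x\<close> lies on a
  wall, and two shifts share a direction. Subtracting cancels the coordinate of \<open>x\<close>, so
  the difference of the shifts would be an integer strictly between 0 and 1.\<close>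

lemma ex_wall_weight_pos:
  fixes x :: "'a::euclidean_space"
  shows "\<exists>i\<in>{1..DIM('a)+1}. wall_weight N (real i / real (DIM('a)+2)) x > 0"
proof (rule ccontr)
  assume "\<not> ?thesis"
  then have "\<forall>i\<in>{1..DIM('a)+1}. \<exists>b\<in>Basis. N * (x \<bullet> b) - real i / real (DIM('a)+2) \<in> \<int>"
    using wall_weight_nonneg wall_weight_eq_0_iff by (metis less_eq_real_def)
  then obtain f where f: "\<And>i. i \<in> {1..DIM('a)+1} \<Longrightarrow>
      f i \<in> Basis \<and> N * (x \<bullet> f i) - real i / real (DIM('a)+2) \<in> \<int>"
    by metis
  have "\<not> inj_on f {1..DIM('a)+1}"
    by (rule pigeonhole) (use f in \<open>auto intro!: le_less_trans[OF card_mono[of Basis]]\<close>)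
  then obtain i j where ij: "i \<in> {1..DIM('a)+1}" "j \<in> {1..DIM('a)+1}" "i < j" "f i = f j"
    by (auto simp: inj_on_def) (metis nat_neq_iff)
  have "(N * (x \<bullet> f i) - real i / real (DIM('a)+2))
      - (N * (x \<bullet> f j) - real j / real (DIM('a)+2)) \<in> \<int>"
    using f[OF ij(1)] f[OF ij(2)] by (metis Ints_diff)
  then have "(real j - real i) / real (DIM('a)+2) \<in> \<int>"
    using ij(4) by (simp add: diff_divide_distrib)
  moreover have "0 < (real j - real i) / real (DIM('a)+2)"
    and "(real j - real i) / real (DIM('a)+2) < 1"
    using ij by (auto simp: field_simps)
  ultimately show False
    by (metis Ints_cases of_int_0_less_iff of_int_less_1_iff int_one_le_iff_zero_less not_less)
qed

lemma eventually_floor_eq: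
  fixes y :: real
  assumes "y \<notin> \<int>"
  shows "\<forall>\<^sub>F z in nhds y. \<lfloor>z\<rfloor> = \<lfloor>y\<rfloor>"
proof -
  have "of_int \<lfloor>y\<rfloor> < y"
    using assms by (metis Ints_of_int of_int_floor_le order_le_less)
  then have "y \<in> {of_int \<lfloor>y\<rfloor><..<of_int \<lfloor>y\<rfloor> + 1}"
    by simp
  then have "\<forall>\<^sub>F z in nhds y. z \<in> {of_int \<lfloor>y\<rfloor><..<of_int \<lfloor>y\<rfloor> + 1}"
    by (intro eventually_nhds_in_open) auto
  then show ?thesis
    by eventually_elim (simp add: floor_eq_iff)
qed

lemma eventually_grid_cell_eq:
  assumes "wall_weight N s x \<noteq> 0"
  shows "\<forall>\<^sub>F y in at x. grid_cell N s y = grid_cell N s x"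
proof -
  have "\<forall>\<^sub>F y in at x. \<lfloor>N * (y \<bullet> b) - s\<rfloor> = \<lfloor>N * (x \<bullet> b) - s\<rfloor>" if "b \<in> Basis" for b
  proof -
    have "N * (x \<bullet> b) - s \<notin> \<int>"
      using assms that wall_weight_eq_0_iff by blast
    moreover have "((\<lambda>y. N * (y \<bullet> b) - s) \<longlongrightarrow> N * (x \<bullet> b) - s) (at x)"
      by (intro tendsto_intros)
    ultimately show ?thesis
      by (intro eventually_compose_filterlim[OF eventually_floor_eq])
  qed
  then have "\<forall>\<^sub>F y in at x. \<forall>b\<in>Basis. \<lfloor>N * (y \<bullet> b) - s\<rfloor> = \<lfloor>N * (x \<bullet> b) - s\<rfloor>"
    by (simp add: eventually_ball_finite)
  then show ?thesis
    by eventually_elim (auto simp: grid_cell_def restrict_def)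
qed

text \<open>Off the walls the cube, hence the value of \<open>c\<close>, is locally constant. On a
  wall \<open>c\<close> may jump, but it stays bounded while the weight tends to 0.\<close>

lemma isCont_wall_weight_scaleR:
  fixes c :: "('a::euclidean_space \<Rightarrow> int) \<Rightarrow> 'b::real_normed_vector"
  assumes "bounded (range c)"
  shows "isCont (\<lambda>x. wall_weight N s x *\<^sub>R c (grid_cell N s x)) x"
proof (cases "wall_weight N s x = 0")
  case True
  have "(wall_weight N s \<longlongrightarrow> 0) (at x)"
    using isCont_wall_weight[where N = N and s = s and x = x] True by (simp add: isCont_def)
  moreover obtain B where "\<And>m. norm (c m) \<le> B"
    using assms by (auto simp: bounded_iff)
  then have "norm (wall_weight N s y *\<^sub>R c (grid_cell N s y)) \<le> norm (wall_weight N s y) * B" for y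
    unfolding norm_scaleR real_norm_def by (intro mult_left_mono) auto
  ultimately have "((\<lambda>y. wall_weight N s y *\<^sub>R c (grid_cell N s y)) \<longlongrightarrow> 0) (at x)"
    by (rule tendsto_0_le[where K = B, OF _ always_eventually[OF allI]])
  then show ?thesis
    using True by (simp add: isCont_def)
next
  case False
  have "((\<lambda>y. wall_weight N s y *\<^sub>R c (grid_cell N s x)) \<longlongrightarrow>
      wall_weight N s x *\<^sub>R c (grid_cell N s x)) (at x)"
    using isCont_wall_weight[where N = N and s = s and x = x]
    by (intro tendsto_intros) (simp add: isCont_def)
  moreover have "\<forall>\<^sub>F y in at x. wall_weight N s y *\<^sub>R c (grid_cell N s x)
      = wall_weight N s y *\<^sub>R c (grid_cell N s y)"
    using eventually_grid_cell_eq[OF False] by eventually_elim simp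
  ultimately show ?thesis
    unfolding isCont_def by (rule Lim_transform_eventually)
qed

section \<open>Brouwer's theorem for interpolated grid selections\<close>

text \<open>The weighted average of the points attached to the d + 1 cubes around \<open>x\<close>
  is a continuous self-map of \<open>S\<close>: its total weight is always positive. At a fixed
  point this average is \<open>x\<close> itself.\<close>

lemma grid_selection_fixed_point:
  fixes S :: "'a::euclidean_space set" and c :: "nat \<Rightarrow> ('a \<Rightarrow> int) \<Rightarrow> 'a"
  assumes "compact S" "convex S"
    and c: "\<And>i m. i \<in> {1..DIM('a)+1} \<Longrightarrow> c i m \<in> S"
  obtains x where "x \<in> S"
    and "x \<in> convex hull
      ((\<lambda>i. c i (grid_cell N (real i / real (DIM('a)+2)) x)) ` {1..DIM('a)+1})"
proof -
  define I where "I = {1..DIM('a)+1}"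
  define w where "w i x = wall_weight N (real i / real (DIM('a)+2)) x" for i and x :: 'a
  define p where "p i x = c i (grid_cell N (real i / real (DIM('a)+2)) x)" for i and x :: 'a
  define W where "W x = (\<Sum>i\<in>I. w i x)" for x
  define g where "g x = (\<Sum>i\<in>I. w i x *\<^sub>R p i x) /\<^sub>R W x" for x
  have w_nonneg: "w i x \<ge> 0" for i x
    by (simp add: w_def wall_weight_nonneg)
  have W_pos: "W x > 0" for x
  proof -
    obtain i where "i \<in> I" "w i x > 0"
      using ex_wall_weight_pos[of N x] by (auto simp only: w_def I_def)
    then show ?thesis
      unfolding W_def using w_nonneg by (intro sum_pos2[of I i]) (auto simp: I_def)
  qed
  have g_hull: "g x \<in> convex hull ((\<lambda>i. p i x) ` I)" for x
  proof -
    have "(\<Sum>i\<in>I. (w i x / W x) *\<^sub>R p i x) \<in> convex hull ((\<lambda>i. p i x) ` I)"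
    proof (rule convex_sum)
      show "(\<Sum>i\<in>I. w i x / W x) = 1"
        using W_pos[of x] by (simp add: W_def flip: sum_divide_distrib)
    qed (use w_nonneg W_pos[of x] in \<open>auto simp: I_def intro: hull_inc\<close>)
    then show ?thesis
      by (simp add: g_def scaleR_sum_right divide_inverse_commute)
  qed
  have "bounded (range (c i))" if "i \<in> I" for i
    by (rule bounded_subset[OF compact_imp_bounded[OF \<open>compact S\<close>]])
      (use c that in \<open>auto simp: I_def\<close>)
  then have "isCont (\<lambda>x. w i x *\<^sub>R p i x) x" if "i \<in> I" for i x
    using that isCont_wall_weight_scaleR unfolding w_def p_def by blast
  moreover have "isCont (w i) x" for i x
    using isCont_wall_weight by (simp add: w_def[abs_def])
  ultimately have "isCont g x" for x
    using W_pos[of x] unfolding g_def W_def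
    by (intro isCont_scaleR continuous_at_within_inverse isCont_sum) auto
  then have "continuous_on S g"
    by (simp add: continuous_at_imp_continuous_on)
  moreover have "g \<in> S \<rightarrow> S"
  proof
    fix x
    have "convex hull ((\<lambda>i. p i x) ` I) \<subseteq> S"
      using c \<open>convex S\<close> by (intro hull_minimal) (auto simp: p_def I_def)
    then show "g x \<in> S"
      using g_hull by blast
  qed
  moreover have "S \<noteq> {}"
    using c[of 1] by auto
  ultimately obtain x where "x \<in> S" "g x = x"
    using brouwer[of S g] assms(1,2) by metis
  then show ?thesis
    using that g_hull[of x] by (simp add: p_def I_def)
qed

section \<open>Size and overlap of grid cells\<close>

lemma dist_less_if_grid_cell_eq:
  fixes x y :: "'a::euclidean_space"
  assumes "grid_cell N s x = grid_cell N s y" and "N > 0"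
  shows "dist x y < real DIM('a) / N"
proof -
  have "\<bar>(x - y) \<bullet> b\<bar> < 1 / N" if "b \<in> Basis" for b
  proof -
    have "\<lfloor>N * (x \<bullet> b) - s\<rfloor> = \<lfloor>N * (y \<bullet> b) - s\<rfloor>"
      using fun_cong[OF assms(1), of b] that by (simp add: grid_cell_def)
    then have "\<bar>N * (x \<bullet> b) - N * (y \<bullet> b)\<bar> < 1"
      by linarith
    then have "N * \<bar>(x - y) \<bullet> b\<bar> < 1"
      using \<open>N > 0\<close> by (simp add: inner_diff_left abs_mult flip: right_diff_distrib)
    then show ?thesis
      using \<open>N > 0\<close> by (simp add: field_simps)
  qed
  then have "(\<Sum>b\<in>Basis. \<bar>(x - y) \<bullet> b\<bar>) < (\<Sum>b\<in>(Basis::'a set). 1 / N)"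
    by (intro sum_strict_mono) auto
  then show ?thesis
    using norm_le_l1[of "x - y"] by (simp add: dist_norm)
qed

text \<open>Subtracting a shift between 0 and 1 lowers a floor by at most 1. Hence a shifted cube
  meets at most 2^d cells of the unshifted grid, which is where the power of 2 in the class size
  comes from.\<close>

lemma grid_cell_shift:
  fixes x :: "'a::euclidean_space"
  assumes "0 \<le> s" "s \<le> 1"
  shows "grid_cell N 0 x \<in> PiE Basis (\<lambda>b. {grid_cell N s x b, grid_cell N s x b + 1})"
proof -
  have "\<lfloor>u\<rfloor> = \<lfloor>u - s\<rfloor> \<or> \<lfloor>u\<rfloor> = \<lfloor>u - s\<rfloor> + 1" for u
    using assms by linarith
  then show ?thesis
    by (auto simp: grid_cell_def)
qed

section \<open>Hitting sets and counting\<close>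

text \<open>Greedy choice: either the disjoint members chosen so far extend by another one, or their
  union meets every member of \<open>F\<close>, and it has at most \<open>k\<close> points per
  chosen member.\<close>

lemma disjoint_family_or_hitting_set:
  assumes "\<And>A. A \<in> F \<Longrightarrow> finite A \<and> card A \<le> k"
  shows "(\<exists>R. (\<forall>i\<in>{1..r}. R i \<in> F) \<and>
        (\<forall>i\<in>{1..r}. \<forall>j\<in>{1..r}. i \<noteq> j \<longrightarrow> R i \<inter> R j = {})) \<or>
    (\<exists>Y. finite Y \<and> card Y \<le> r * k \<and> (\<forall>A\<in>F. A \<inter> Y \<noteq> {}))"
proof (induction r)
  case 0
  show ?case
    by auto
next
  case (Suc r)
  from Suc.IH show ?case
  proof (elim disjE exE conjE)
    fix Y assume "finite Y" "card Y \<le> r * k" "\<forall>A\<in>F. A \<inter> Y \<noteq> {}"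
    then show ?case
      by (metis le_add2 mult_Suc order_trans)
  next
    fix R assume R: "\<forall>i\<in>{1..r}. R i \<in> F"
      "\<forall>i\<in>{1..r}. \<forall>j\<in>{1..r}. i \<noteq> j \<longrightarrow> R i \<inter> R j = {}"
    define Y where "Y = (\<Union>i\<in>{1..r}. R i)"
    show ?case
    proof (cases "\<exists>A\<in>F. A \<inter> Y = {}")
      case True
      then obtain A where A: "A \<in> F" "\<forall>i\<in>{1..r}. A \<inter> R i = {}"
        by (auto simp: Y_def)
      have "\<forall>i\<in>{1..Suc r}. (R(Suc r := A)) i \<in> F"
        using A R by auto
      moreover have "\<forall>i\<in>{1..Suc r}. \<forall>j\<in>{1..Suc r}. i \<noteq> j \<longrightarrow>
          (R(Suc r := A)) i \<inter> (R(Suc r := A)) j = {}"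
      proof (intro ballI impI)
        fix i j assume "i \<in> {1..Suc r}" "j \<in> {1..Suc r}" "i \<noteq> j"
        then consider "i = Suc r" "j \<in> {1..r}" | "j = Suc r" "i \<in> {1..r}"
          | "i \<in> {1..r}" "j \<in> {1..r}"
          by fastforce
        then show "(R(Suc r := A)) i \<inter> (R(Suc r := A)) j = {}"
          using A(2) R(2) \<open>i \<noteq> j\<close> by cases (auto simp: Int_commute)
      qed
      ultimately show ?thesis
        by blast
    next
      case False
      have "card Y \<le> (\<Sum>i\<in>{1..r}. card (R i))"
        unfolding Y_def by (rule card_UN_le) simp
      also have "\<dots> \<le> r * k"
        using sum_bounded_above[of "{1..r}" "\<lambda>i. card (R i)" k] R assms by simp
      finally have "card Y \<le> Suc r * k"
        by simp
      moreover have "finite Y"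
        using R assms by (auto simp: Y_def)
      ultimately show ?thesis
        using False by blast
    qed
  qed
qed

lemma ex_not_in_UN_if_card_less:
  assumes "finite K" and "\<And>k. k \<in> K \<Longrightarrow> finite (W k) \<and> card (W k) \<le> n" and "card K * n < card A"
  shows "\<exists>a\<in>A. \<forall>k\<in>K. a \<notin> W k"
proof (rule ccontr)
  assume "\<not> ?thesis"
  then have "A \<subseteq> (\<Union>k\<in>K. W k)"
    by auto
  then have "card A \<le> card (\<Union>k\<in>K. W k)"
    using assms by (intro card_mono) auto
  also have "\<dots> \<le> (\<Sum>k\<in>K. card (W k))"
    using assms by (intro card_UN_le)
  also have "\<dots> \<le> card K * n"
    using sum_bounded_above[of K "\<lambda>k. card (W k)" n] assms by simp
  finally show False
    using assms by simp
qed

section \<open>Rainbow sets with a common point in their hulls\<close>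

theorem theorem1:
  fixes r :: nat
  assumes "r \<ge> 2"
  shows "\<exists>t::nat. t > 0 \<and>
    (\<forall>(C :: 'a::euclidean_space set) (Cl :: nat \<Rightarrow> 'a set).
      finite C \<and> card C = (DIM('a) + 1) * t \<and>
      C = (\<Union>j\<in>{1..DIM('a)+1}. Cl j) \<and>
      (\<forall>j\<in>{1..DIM('a)+1}. card (Cl j) = t) \<and>
      (\<forall>j\<in>{1..DIM('a)+1}. \<forall>k\<in>{1..DIM('a)+1}. j \<noteq> k \<longrightarrow> Cl j \<inter> Cl k = {})
      \<longrightarrow>
      (\<exists>R :: nat \<Rightarrow> 'a set.
         (\<forall>i\<in>{1..r}. R i \<subseteq> C) \<and>
         (\<forall>i\<in>{1..r}. \<forall>i'\<in>{1..r}. i \<noteq> i' \<longrightarrow> R i \<inter> R i' = {}) \<and>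
         (\<forall>i\<in>{1..r}. \<forall>j\<in>{1..DIM('a)+1}. card (R i \<inter> Cl j) \<le> 1) \<and>
         (\<Inter>i\<in>{1..r}. convex hull (R i)) \<noteq> {}))"
\<comment> \<open>One more than 2^d cells times the r (d + 1) points forbidden by each, so that
  every class keeps an allowed point.\<close>
proof (rule exI[of _ "2 ^ DIM('a) * (r * (DIM('a) + 1)) + 1"], intro conjI allI impI; (elim conjE)?)
  define n where "n = r * (DIM('a) + 1)"
  show "0 < 2 ^ DIM('a) * (r * (DIM('a) + 1)) + 1"
    by simp
  fix C :: "'a set" and Cl :: "nat \<Rightarrow> 'a set"
  define I where "I = {1..DIM('a)+1}"
  assume "finite C" and C: "C = (\<Union>j\<in>{1..DIM('a)+1}. Cl j)"
    and card_Cl: "\<forall>j\<in>{1..DIM('a)+1}. card (Cl j) = 2 ^ DIM('a) * (r * (DIM('a) + 1)) + 1"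
    and disj: "\<forall>j\<in>{1..DIM('a)+1}. \<forall>k\<in>{1..DIM('a)+1}. j \<noteq> k \<longrightarrow> Cl j \<inter> Cl k = {}"
  define rainbow where "rainbow = {R. R \<subseteq> C \<and> (\<forall>j\<in>I. card (R \<inter> Cl j) \<le> 1)}"
  have "finite rainbow"
    by (rule finite_subset[of _ "Pow C"]) (use \<open>finite C\<close> in \<open>auto simp: rainbow_def\<close>)
  have rainbow_card: "finite R \<and> card R \<le> DIM('a) + 1" if "R \<in> rainbow" for R
  proof -
    have "finite R" and "R = (\<Union>j\<in>I. R \<inter> Cl j)"
      using that C \<open>finite C\<close> by (auto simp: rainbow_def I_def intro: finite_subset)
    then have "card R \<le> (\<Sum>j\<in>I. card (R \<inter> Cl j))"
      using card_UN_le[of I "\<lambda>j. R \<inter> Cl j"] by (simp add: I_def)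
    also have "\<dots> \<le> card I"
      using sum_bounded_above[of I "\<lambda>j. card (R \<inter> Cl j)" 1] that by (simp add: rainbow_def)
    finally show ?thesis
      using \<open>finite R\<close> by (simp add: I_def)
  qed
  show "\<exists>R :: nat \<Rightarrow> 'a set.
         (\<forall>i\<in>{1..r}. R i \<subseteq> C) \<and>
         (\<forall>i\<in>{1..r}. \<forall>i'\<in>{1..r}. i \<noteq> i' \<longrightarrow> R i \<inter> R i' = {}) \<and>
         (\<forall>i\<in>{1..r}. \<forall>j\<in>{1..DIM('a)+1}. card (R i \<inter> Cl j) \<le> 1) \<and>
         (\<Inter>i\<in>{1..r}. convex hull (R i)) \<noteq> {}" (is "Ex ?P")
  proof (rule ccontr)
    assume no_R: "\<nexists>R. ?P R"
    \<comment> \<open>The dichotomy is applied to the rainbow sets whose hull contains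
      \<open>x\<close>; \<open>r\<close> disjoint ones would contradict \<open>no_R\<close>.\<close>
    have "\<exists>Y. finite Y \<and> card Y \<le> n \<and> (\<forall>R\<in>rainbow. x \<in> convex hull R \<longrightarrow> R \<inter> Y \<noteq> {})" for x
    proof -
      let ?F = "{R\<in>rainbow. x \<in> convex hull R}"
      have no_disjoint: "\<not> (\<exists>R. (\<forall>i\<in>{1..r}. R i \<in> ?F) \<and>
          (\<forall>i\<in>{1..r}. \<forall>j\<in>{1..r}. i \<noteq> j \<longrightarrow> R i \<inter> R j = {}))"
      proof clarify
        fix R assume R: "\<forall>i\<in>{1..r}. R i \<in> ?F"
          "\<forall>i\<in>{1..r}. \<forall>j\<in>{1..r}. i \<noteq> j \<longrightarrow> R i \<inter> R j = {}"
        then have "x \<in> (\<Inter>i\<in>{1..r}. convex hull (R i))"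
          by blast
        then have "(\<Inter>i\<in>{1..r}. convex hull (R i)) \<noteq> {}"
          by blast
        moreover have "\<forall>i\<in>{1..r}. R i \<subseteq> C"
          and "\<forall>i\<in>{1..r}. \<forall>j\<in>{1..DIM('a)+1}. card (R i \<inter> Cl j) \<le> 1"
          using R(1) unfolding rainbow_def I_def by blast+
        ultimately have "?P R"
          using R(2) by (intro conjI)
        then have "Ex ?P"
          by (rule exI[of ?P R])
        with no_R show False
          by (rule notE)
      qed
      have "\<exists>Y. finite Y \<and> card Y \<le> n \<and> (\<forall>R\<in>?F. R \<inter> Y \<noteq> {})"
        unfolding n_def
        by (rule disjoint_family_or_hitting_set[THEN iffD1[OF disj_imp], THEN mp, OF _ no_disjoint])
          (use rainbow_card in auto)
      then show ?thesis
        by (metis (no_types, lifting) mem_Collect_eq)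
    qed
    then obtain Y where Y: "\<And>x. finite (Y x)" "\<And>x. card (Y x) \<le> n"
      "\<And>x R. R \<in> rainbow \<Longrightarrow> x \<in> convex hull R \<Longrightarrow> R \<inter> Y x \<noteq> {}"
      by metis
    \<comment> \<open>The points at which \<open>Y z\<close> still hits every rainbow set whose hull
      contains them. Removing finitely many compact hulls leaves an open set.\<close>
    define U where "U z = - (\<Union>R\<in>{R\<in>rainbow. R \<inter> Y z = {}}. convex hull R)" for z
    have "open (U z)" for z
      unfolding U_def using \<open>finite rainbow\<close> rainbow_card
      by (intro open_Compl closed_UN) (auto intro!: compact_imp_closed finite_imp_compact_convex_hull)
    moreover have "z \<in> U z" for z
      using Y(3) by (auto simp: U_def)
    then have "convex hull C \<subseteq> \<Union> (range U)"
      by blast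
    moreover have compact_hull: "compact (convex hull C)"
      using \<open>finite C\<close> by (rule finite_imp_compact_convex_hull)
    \<comment> \<open>\<open>\<epsilon>\<close> is a Lebesgue number of the cover by the sets
      \<open>U z\<close>; the choice of \<open>N\<close> then makes any two points of a cell closer
      than \<open>\<epsilon>\<close>.\<close>
    ultimately obtain \<epsilon> where "\<epsilon> > 0"
      and \<epsilon>: "\<And>x. x \<in> convex hull C \<Longrightarrow> \<exists>G\<in>range U. ball x \<epsilon> \<subseteq> G"
      using Heine_Borel_lemma[of "convex hull C" "range U"] by (metis (no_types, lifting) imageE)
    define N where "N = real DIM('a) / \<epsilon>"
    have "N > 0"
      using \<open>\<epsilon> > 0\<close> by (simp add: N_def)
    have "\<exists>W. finite W \<and> card W \<le> n \<and> (\<forall>x\<in>convex hull C. grid_cell N 0 x = k \<longrightarrow>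
        (\<forall>R\<in>rainbow. x \<in> convex hull R \<longrightarrow> R \<inter> W \<noteq> {}))" for k
    \<comment> \<open>A cell that meets the hull of \<open>C\<close> lies in a ball around one of
      its points there, hence in a single \<open>U z\<close>, and takes \<open>Y z\<close>. For any
      other cell the condition is vacuous and the empty set serves.\<close>
    proof (cases "\<exists>x\<in>convex hull C. grid_cell N 0 x = k")
      case True
      then obtain x where x: "x \<in> convex hull C" "grid_cell N 0 x = k"
        by blast
      then obtain z where z: "ball x \<epsilon> \<subseteq> U z"
        using \<epsilon> by blast
      have "y \<in> U z" if "grid_cell N 0 y = k" for y
        using dist_less_if_grid_cell_eq[of N 0 x y] x(2) that \<open>N > 0\<close> z \<open>\<epsilon> > 0\<close>
        by (auto simp: N_def)
      then have "R \<inter> Y z \<noteq> {}" if "grid_cell N 0 y = k" "R \<in> rainbow" "y \<in> convex hull R" for y R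
        using that unfolding U_def by blast
      then show ?thesis
        using Y(1,2) by blast
    next
      case False
      then show ?thesis
        by (intro exI[of _ "{}"]) auto
    qed
    then obtain W where W: "\<And>k. finite (W k)" "\<And>k. card (W k) \<le> n"
      "\<And>x R. x \<in> convex hull C \<Longrightarrow> R \<in> rainbow \<Longrightarrow> x \<in> convex hull R \<Longrightarrow> R \<inter> W (grid_cell N 0 x) \<noteq> {}"
      by metis
    \<comment> \<open>The unshifted cells that the cube \<open>m\<close> of a shifted grid can
      meet.\<close>
    define near where "near m = PiE (Basis::'a set) (\<lambda>b. {m b, m b + 1})" for m :: "'a \<Rightarrow> int"
    have near: "finite (near m)" "card (near m) = 2 ^ DIM('a)" for m
      by (auto simp: near_def finite_PiE card_PiE numeral_2_eq_2)
    have "\<exists>a\<in>Cl i. \<forall>k\<in>near m. a \<notin> W k" if "i \<in> I" for i m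
      by (rule ex_not_in_UN_if_card_less[where n = n])
        (use W near card_Cl that in \<open>auto simp: n_def I_def\<close>)
    then obtain c where c: "\<And>i m. i \<in> I \<Longrightarrow> c i m \<in> Cl i"
      "\<And>i m k. i \<in> I \<Longrightarrow> k \<in> near m \<Longrightarrow> c i m \<notin> W k"
      by metis
    have "c i m \<in> convex hull C" if "i \<in> {1..DIM('a)+1}" for i m
      using c(1) that C by (auto simp: I_def intro!: hull_inc)
    then obtain x where x: "x \<in> convex hull C"
      "x \<in> convex hull ((\<lambda>i. c i (grid_cell N (real i / real (DIM('a)+2)) x)) ` I)"
      unfolding I_def
      by (rule grid_selection_fixed_point[OF compact_hull convex_convex_hull, where N = N])
    define p where "p i = c i (grid_cell N (real i / real (DIM('a)+2)) x)" for i
    have p: "p i \<in> Cl i" if "i \<in> I" for i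
      using c(1) that by (simp add: p_def)
    have "card (p ` I \<inter> Cl j) \<le> 1" if "j \<in> I" for j
    proof -
      \<comment> \<open>Each \<open>p i\<close> has colour \<open>i\<close> and the classes are
        disjoint, so colour \<open>j\<close> occurs only at \<open>p j\<close>.\<close>
      have "p ` I \<inter> Cl j \<subseteq> {p j}"
      proof
        fix q assume "q \<in> p ` I \<inter> Cl j"
        then obtain i where "i \<in> I" "q = p i" "p i \<in> Cl j"
          by blast
        moreover from this have "i = j"
          using p[of i] disj that unfolding I_def by blast
        ultimately show "q \<in> {p j}"
          by simp
      qed
      then show ?thesis
        using card_mono[of "{p j}"] by simp
    qed
    then have "p ` I \<in> rainbow"
      using p C by (auto simp: rainbow_def I_def)
    moreover have "p i \<notin> W (grid_cell N 0 x)" if "i \<in> I" for i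
      unfolding p_def
      by (rule c(2)[OF that]) (use that in \<open>auto simp: near_def I_def intro!: grid_cell_shift\<close>)
    ultimately show False
      using W(3)[of x "p ` I"] x by (auto simp: p_def)
  qed
qed

end
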